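(* Let $L$ be a finite lattice whose greatest element $1$ is join-reducible. The following statements are equivalent. (a) $L$ is a lower dismantlable lattice. (b) Every nonzero element of $L$ is meet-irreducible. (c) The cover graph $CG(L\setminus\{0\})$ of $L\setminus\{0\}$ is a tree. (d) The zero-divisor graph $G_{\{0\}}(L)$ coincides with the incomparability graph of $L\setminus\{0,1\}$.
   Context: Adjunct operation: for disjoint finite lattices $L_1,L_2$ and $a<b$ in $L_1$ with $b$ not covering $a$, $L_1]_a^bL_2$ is $L_1\cup L_2$ ordered by: $x\le y$ iff ($x,y\in L_1$, $x\le y$ in $L_1$) or ($x,y\in L_2$, $x\le y$ in $L_2$) or ($x\in L_1$, $y\in L_2$, $x\le a$) or ($x\in L_2$, $y\in L_1$, $b\le y$); $(a,b)$ is an adjunct pair. A finite lattice is dismantlable iff it is an adjunct of chains $C_0]_{a_1}^{b_1}C_1\cdots]_{a_n}^{b_n}C_n$; it is lower dismantlable if it is a chain or every adjunct pair is of the form $(0,b)$. An element $x$ is join-reducible (meet-reducible) if $x=y\vee z$ ($x=y\wedge z$) for some $y,z\ne x$, and meet-irreducible if not meet-reducible. The cover graph of a poset $P$ has vertex set $P$, with $x,y$ adjacent iff one covers the other. The incomparability graph of a poset has as edges the pairs of incomparable elements. The zero-divisor graph $G_{\{0\}}(L)$ has vertex set $\{x\in L\setminus\{0\}: x\wedge y=0\text{ for some }y\in L\setminus\{0\}\}$, distinct vertices $x,y$ adjacent iff $x\wedge y=0$. *)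

theory Defs
  imports "HOL-Algebra.Lattice" "Graph_Theory.Graph_Theory"
begin

section \<open>Posets and lattices\<close>

definition finite_lattice :: "'a gorder \<Rightarrow> bool" where
  "finite_lattice L \<longleftrightarrow> lattice L \<and> finite (carrier L) \<and> carrier L \<noteq> {}"

definition finite_chain :: "'a gorder \<Rightarrow> bool" where
  "finite_chain C \<longleftrightarrow> total_order C \<and> finite (carrier C) \<and> carrier C \<noteq> {}"

text \<open>\<open>covers P y x\<close> reads ``\<open>y\<close> covers \<open>x\<close> in \<open>P\<close>''.\<close>

definition covers :: "'a gorder \<Rightarrow> 'a \<Rightarrow> 'a \<Rightarrow> bool" where
  "covers P y x \<longleftrightarrow> x \<in> carrier P \<and> y \<in> carrier P \<and> x \<sqsubset>\<^bsub>P\<^esub> y \<and>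
     \<not> (\<exists>z\<in>carrier P. x \<sqsubset>\<^bsub>P\<^esub> z \<and> z \<sqsubset>\<^bsub>P\<^esub> y)"

definition join_reducible :: "'a gorder \<Rightarrow> 'a \<Rightarrow> bool" where
  "join_reducible L x \<longleftrightarrow> x \<in> carrier L \<and>
     (\<exists>y\<in>carrier L. \<exists>z\<in>carrier L. y \<noteq> x \<and> z \<noteq> x \<and> x = y \<squnion>\<^bsub>L\<^esub> z)"

definition meet_reducible :: "'a gorder \<Rightarrow> 'a \<Rightarrow> bool" where
  "meet_reducible L x \<longleftrightarrow> x \<in> carrier L \<and>
     (\<exists>y\<in>carrier L. \<exists>z\<in>carrier L. y \<noteq> x \<and> z \<noteq> x \<and> x = y \<sqinter>\<^bsub>L\<^esub> z)"

definition meet_irreducible :: "'a gorder \<Rightarrow> 'a \<Rightarrow> bool" where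
  "meet_irreducible L x \<longleftrightarrow> x \<in> carrier L \<and> \<not> meet_reducible L x"

definition subposet :: "'a gorder \<Rightarrow> 'a set \<Rightarrow> 'a gorder" where
  "subposet P A = P\<lparr>carrier := A\<rparr>"

section \<open>Adjuncts and lower dismantlable lattices\<close>

definition adjunct :: "'a gorder \<Rightarrow> 'a \<Rightarrow> 'a \<Rightarrow> 'a gorder \<Rightarrow> 'a gorder" where
  "adjunct L1 a b L2 =
     \<lparr>carrier = carrier L1 \<union> carrier L2,
      eq = (=),
      le = (\<lambda>x y.
          (x \<in> carrier L1 \<and> y \<in> carrier L1 \<and> x \<sqsubseteq>\<^bsub>L1\<^esub> y)
        \<or> (x \<in> carrier L2 \<and> y \<in> carrier L2 \<and> x \<sqsubseteq>\<^bsub>L2\<^esub> y)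
        \<or> (x \<in> carrier L1 \<and> y \<in> carrier L2 \<and> x \<sqsubseteq>\<^bsub>L1\<^esub> a)
        \<or> (x \<in> carrier L2 \<and> y \<in> carrier L1 \<and> b \<sqsubseteq>\<^bsub>L1\<^esub> y))\<rparr>"

text \<open>
  \<open>adjunct_of_chains L [(a\<^sub>1, b\<^sub>1), \<dots>, (a\<^sub>n, b\<^sub>n)]\<close> means that \<open>L\<close> is an adjunct of chains
  \<open>C\<^sub>0, \<dots>, C\<^sub>n\<close>, formed from left to right, with these adjunct pairs.
\<close>

inductive adjunct_of_chains :: "'a gorder \<Rightarrow> ('a \<times> 'a) list \<Rightarrow> bool" where
  chain: "finite_chain C \<Longrightarrow> adjunct_of_chains C []"
| adjunct: "adjunct_of_chains L ps \<Longrightarrow> finite_chain C \<Longrightarrow> carrier L \<inter> carrier C = {} \<Longrightarrow>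
    a \<in> carrier L \<Longrightarrow> b \<in> carrier L \<Longrightarrow> a \<sqsubset>\<^bsub>L\<^esub> b \<Longrightarrow> \<not> covers L b a \<Longrightarrow>
    adjunct_of_chains (adjunct L a b C) (ps @ [(a, b)])"

text \<open>
  The values of \<open>le\<close> outside the carrier are irrelevant, so ``\<open>L\<close> is the adjunct \<open>M\<close>'' must not
  be read as equality of records.
\<close>

definition same_poset :: "'a gorder \<Rightarrow> 'a gorder \<Rightarrow> bool" where
  "same_poset P Q \<longleftrightarrow> carrier P = carrier Q \<and>
     (\<forall>x\<in>carrier P. \<forall>y\<in>carrier P. x \<sqsubseteq>\<^bsub>P\<^esub> y \<longleftrightarrow> x \<sqsubseteq>\<^bsub>Q\<^esub> y)"

definition adjunct_representation :: "'a gorder \<Rightarrow> ('a \<times> 'a) list \<Rightarrow> bool" where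
  "adjunct_representation L ps \<longleftrightarrow> (\<exists>M. adjunct_of_chains M ps \<and> same_poset L M)"

definition dismantlable :: "'a gorder \<Rightarrow> bool" where
  "dismantlable L \<longleftrightarrow> finite_lattice L \<and> (\<exists>ps. adjunct_representation L ps)"

definition adjunct_pairs :: "'a gorder \<Rightarrow> ('a \<times> 'a) set" where
  "adjunct_pairs L = (\<Union>ps\<in>{ps. adjunct_representation L ps}. set ps)"

definition lower_dismantlable :: "'a gorder \<Rightarrow> bool" where
  "lower_dismantlable L \<longleftrightarrow> dismantlable L \<and>
     (finite_chain L \<or> (\<forall>(a, b)\<in>adjunct_pairs L. a = \<bottom>\<^bsub>L\<^esub>))"

section \<open>Graphs\<close>

text \<open>
  Undirected simple graphs are symmetric loop-free digraphs. In such a digraph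
  \<^const>\<open>pre_digraph.cycle\<close> also holds of the closed walk \<open>u, v, u\<close> along a single edge, so
  \<^const>\<open>tree\<close> is not the undirected notion; the cycles of the undirected graph are those of
  length at least 3.
\<close>

definition undirected_tree :: "'a pair_pre_digraph \<Rightarrow> bool" where
  "undirected_tree G \<longleftrightarrow> connected (with_proj G) \<and>
     \<not> (\<exists>p. pre_digraph.cycle (with_proj G) p \<and> length p \<ge> 3)"

definition cover_graph :: "'a gorder \<Rightarrow> 'a pair_pre_digraph" where
  "cover_graph P =
     \<lparr>pverts = carrier P,
      parcs = {(x, y). x \<in> carrier P \<and> y \<in> carrier P \<and> (covers P x y \<or> covers P y x)}\<rparr>"

definition incomparability_graph :: "'a gorder \<Rightarrow> 'a pair_pre_digraph" where
  "incomparability_graph P =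
     \<lparr>pverts = carrier P,
      parcs = {(x, y). x \<in> carrier P \<and> y \<in> carrier P \<and>
                 \<not> x \<sqsubseteq>\<^bsub>P\<^esub> y \<and> \<not> y \<sqsubseteq>\<^bsub>P\<^esub> x}\<rparr>"

definition zero_divisors :: "'a gorder \<Rightarrow> 'a set" where
  "zero_divisors L =
     {x \<in> carrier L - {\<bottom>\<^bsub>L\<^esub>}. \<exists>y\<in>carrier L - {\<bottom>\<^bsub>L\<^esub>}. x \<sqinter>\<^bsub>L\<^esub> y = \<bottom>\<^bsub>L\<^esub>}"

definition zero_divisor_graph :: "'a gorder \<Rightarrow> 'a pair_pre_digraph" where
  "zero_divisor_graph L =
     \<lparr>pverts = zero_divisors L,
      parcs = {(x, y). x \<in> zero_divisors L \<and> y \<in> zero_divisors L \<and> x \<noteq> y \<and>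
                 x \<sqinter>\<^bsub>L\<^esub> y = \<bottom>\<^bsub>L\<^esub>}\<rparr>"

end

theory Submission
  imports Defs
begin

text \<open>
  All four statements are equivalent to the condition that the elements above any nonzero element
  form a chain, that is, \<open>L - {0}\<close> is a tree order with root \<open>1\<close>.

  An adjunct pair \<open>(a, b)\<close> makes \<open>a\<close> a proper meet, so under the condition only \<open>a = 0\<close> is possible,
  and adding the upper sets of the atoms one at a time produces an adjunct representation; conversely
  adjoining chains at pairs \<open>(0, b)\<close> preserves the condition. If two incomparable elements have
  nonzero meet \<open>x\<close>, then \<open>x\<close> has two upper covers \<open>u, v\<close>, and saturated chains from \<open>u\<close> and \<open>v\<close> to
  \<open>u \<squnion> v\<close> close up to a cycle of the cover graph; conversely a minimal vertex of a cycle has two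
  upper covers.
\<close>

section \<open>Cover graphs of finite posets\<close>

text \<open>Indexed form of the recursive walk predicate, used to step from a position on a cycle to
  the neighbouring arcs.\<close>

lemma pcas_nth:
  assumes "pcas u p v" "i < length p"
  shows "snd (p ! i) = (if Suc i < length p then fst (p ! Suc i) else v)"
  using assms
proof (induction p arbitrary: u i)
  case (Cons e p)
  show ?case
  proof (cases i)
    case 0
    then show ?thesis using Cons.prems by (cases p) auto
  next
    case (Suc j)
    then show ?thesis using Cons.prems Cons.IH[of "snd e" j] by auto
  qed
qed simp

locale finite_poset = partial_order P for P :: "'a gorder" (structure) +
  assumes finite_carrier: "finite (carrier P)"
begin

lemma lless_iff: "x \<sqsubset> y \<longleftrightarrow> x \<sqsubseteq> y \<and> x \<noteq> y"
  by (simp add: lless_def eq_is_equal)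

lemma ex_minimal:
  assumes "A \<subseteq> carrier P" "A \<noteq> {}"
  obtains m where "m \<in> A" "\<And>x. x \<in> A \<Longrightarrow> x \<sqsubseteq> m \<Longrightarrow> x = m"
proof -
  have "finite A"
    using assms(1) finite_carrier by (rule finite_subset)
  moreover have "asymp_on A (\<sqsubset>)"
    using assms(1) by (intro asymp_onI) (auto simp: lless_iff intro: le_antisym)
  moreover have "transp_on A (\<sqsubset>)"
    using assms(1) by (intro transp_onI) (meson lless_trans subsetD)
  ultimately have "\<exists>m\<in>A. \<forall>x\<in>A. x \<noteq> m \<longrightarrow> \<not> x \<sqsubset> m"
    using assms(2) by (intro Finite_Set.bex_min_element)
  then show thesis
    using that by (auto simp: lless_iff)
qed

lemma covers_between:
  assumes "x \<in> carrier P" "y \<in> carrier P" "x \<sqsubset> y"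
  obtains u where "covers P u x" "u \<sqsubseteq> y"
proof -
  let ?A = "{u \<in> carrier P. x \<sqsubset> u \<and> u \<sqsubseteq> y}"
  have "y \<in> ?A" using assms by simp
  then obtain u where u: "u \<in> ?A" and min: "\<And>v. v \<in> ?A \<Longrightarrow> v \<sqsubseteq> u \<Longrightarrow> v = u"
    using ex_minimal[of ?A] by blast
  have "\<not> (x \<sqsubset> v \<and> v \<sqsubset> u)" if "v \<in> carrier P" for v
  proof
    assume v: "x \<sqsubset> v \<and> v \<sqsubset> u"
    then have "v \<sqsubseteq> y" using that u assms(2) by (auto simp: lless_iff intro: le_trans)
    then show False using min[of v] v that by (simp add: lless_iff)
  qed
  then have "covers P u x"
    using u assms(1) by (auto simp: covers_def)
  then show thesis using u that by simp
qed

section \<open>Paths and connectedness in the cover graph\<close>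

lemma pair_graph_cover_graph: "pair_graph (cover_graph P)"
proof
  show "finite (parcs (cover_graph P))"
    by (rule finite_subset[of _ "carrier P \<times> carrier P"])
      (auto simp: cover_graph_def finite_carrier)
qed (auto simp: cover_graph_def finite_carrier covers_def lless_iff symmetric_def intro: symI)

sublocale cg: pair_graph "cover_graph P"
  by (rule pair_graph_cover_graph)

lemma pverts_cover_graph [simp]: "pverts (cover_graph P) = carrier P"
  by (simp add: cover_graph_def)

lemma parcs_cover_graph: "(x, y) \<in> parcs (cover_graph P) \<longleftrightarrow> covers P x y \<or> covers P y x"
  by (auto simp: cover_graph_def covers_def)

text \<open>Climbing by one cover shrinks the set of elements above the current vertex. Keeping all
  vertices inside the interval is what later shows that two such paths meet only at their
  end.\<close>

lemma cover_path_exists: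
  assumes "x \<in> carrier P" "y \<in> carrier P" "x \<sqsubseteq> y"
  shows "\<exists>p. cg.apath x p y \<and> (\<forall>v\<in>set (pawalk_verts x p). x \<sqsubseteq> v \<and> v \<sqsubseteq> y)"
  using assms
proof (induction "card {z \<in> carrier P. x \<sqsubseteq> z}" arbitrary: x rule: less_induct)
  case less
  show ?case
  proof (cases "x = y")
    case True
    then show ?thesis
      using less.prems by (intro exI[of _ "[]"]) (simp add: cg.apath_Nil_iff)
  next
    case False
    with less.prems obtain u where u: "covers P u x" "u \<sqsubseteq> y"
      by (auto simp: lless_iff elim: covers_between)
    then have uc: "u \<in> carrier P" "x \<sqsubseteq> u" "x \<noteq> u"
      by (auto simp: covers_def lless_iff)
    have "{z \<in> carrier P. u \<sqsubseteq> z} \<subset> {z \<in> carrier P. x \<sqsubseteq> z}"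
      using uc less.prems by (auto intro: le_trans dest: le_antisym)
    then have "card {z \<in> carrier P. u \<sqsubseteq> z} < card {z \<in> carrier P. x \<sqsubseteq> z}"
      by (intro psubset_card_mono) (auto simp: finite_carrier)
    from less.hyps[OF this uc(1) less.prems(2) u(2)] obtain p where p: "cg.apath u p y"
      and between: "\<And>v. v \<in> set (pawalk_verts u p) \<Longrightarrow> u \<sqsubseteq> v \<and> v \<sqsubseteq> y"
      by blast
    have carr: "set (pawalk_verts u p) \<subseteq> carrier P"
      using p by (auto simp: cg.apath_def elim!: cg.awalkE')
    have "x \<notin> set (pawalk_verts u p)"
      using between uc less.prems(1) le_antisym by blast
    then have "cg.apath x ((x, u) # p) y"
      using p u(1) by (simp add: cg.apath_Cons_iff parcs_cover_graph)
    moreover have "x \<sqsubseteq> v \<and> v \<sqsubseteq> y" if "v \<in> set (pawalk_verts x ((x, u) # p))" for v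
      using that between carr uc less.prems by (auto intro: le_trans[of x u])
    ultimately show ?thesis by blast
  qed
qed

text \<open>Every vertex climbs to \<open>t\<close>; symmetry of the arcs then leads down to any
  other vertex.\<close>

lemma connected_cover_graph:
  assumes "t \<in> carrier P" "\<And>x. x \<in> carrier P \<Longrightarrow> x \<sqsubseteq> t"
  shows "connected (with_proj (cover_graph P))"
proof -
  have reach: "x \<rightarrow>\<^sup>*\<^bsub>cover_graph P\<^esub> t" if "x \<in> carrier P" for x
    using cover_path_exists[OF that assms(1) assms(2)[OF that]]
    by (auto simp: cg.reachable_awalk cg.apath_def)
  have "x \<rightarrow>\<^sup>*\<^bsub>cover_graph P\<^esub> y" if "x \<in> carrier P" "y \<in> carrier P" for x y
    using reach[OF that(1)] symmetric_reachable[OF cg.sym_arcs reach[OF that(2)]]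
    by (rule cg.reachable_trans)
  \<comment> \<open>\<open>connected\<close> refers to the symmetric closure, which adds no
    reachability here because the arcs are symmetric already.\<close>
  then show ?thesis
    using assms(1) cg.reachable_mk_symmetric_eq[OF cg.sym_arcs]
    by (auto simp: connected_def strongly_connected_def)
qed

section \<open>Cycles of the cover graph\<close>

text \<open>A vertex common to the paths from \<open>u\<close> and \<open>v\<close> up to
  \<open>w\<close> is an upper bound of both and lies below \<open>w\<close>, so it is
  \<open>w\<close>; and \<open>x\<close> lies strictly below both paths. Going up one and down the
  other is thus a cycle. \<open>w\<close> is given by its universal property because
  \<open>P\<close> is only a poset.\<close>

lemma cycle_of_two_covers:
  assumes "covers P u x" "covers P v x" "u \<noteq> v"
    and w: "w \<in> carrier P" "u \<sqsubseteq> w" "v \<sqsubseteq> w"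
    and least: "\<And>c. c \<in> carrier P \<Longrightarrow> u \<sqsubseteq> c \<Longrightarrow> v \<sqsubseteq> c \<Longrightarrow> w \<sqsubseteq> c"
  shows "\<exists>p. cg.cycle p \<and> length p \<ge> 3"
proof -
  have carr: "x \<in> carrier P" "u \<in> carrier P" "v \<in> carrier P"
    and above: "x \<sqsubseteq> u" "x \<noteq> u" "x \<sqsubseteq> v" "x \<noteq> v"
    using assms(1,2) by (auto simp: covers_def lless_iff)
  obtain p where p: "cg.apath u p w" "\<And>c. c \<in> set (pawalk_verts u p) \<Longrightarrow> u \<sqsubseteq> c \<and> c \<sqsubseteq> w"
    using cover_path_exists[OF carr(2) w(1,2)] by blast
  obtain q where q: "cg.apath v q w" "\<And>c. c \<in> set (pawalk_verts v q) \<Longrightarrow> v \<sqsubseteq> c \<and> c \<sqsubseteq> w"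
    using cover_path_exists[OF carr(3) w(1,3)] by blast
  have walks: "cg.awalk u p w" "cg.awalk w (rev_path q) v"
    using p(1) q(1) by (auto simp: cg.apath_def)
  have verts_q: "pawalk_verts w (rev_path q) = rev (pawalk_verts v q)"
    using q(1) by (intro cg.awalk_verts_rev_path) (simp add: cg.apath_def)
  \<comment> \<open>\<open>r\<close> is the descending path without its start \<open>w\<close>, the
    one vertex that it shares with the ascending path.\<close>
  then obtain r where r: "rev (pawalk_verts v q) = w # r"
    using cg.awhd_of_awalk[OF walks(2)] cg.awalk_verts_non_Nil[of w "rev_path q"]
    by (metis list.collapse)
  have distinct_r: "distinct r" "w \<notin> set r"
    using r q(1) unfolding cg.apath_def by (metis distinct.simps(2) distinct_rev)+
  have r_sub: "set r \<subseteq> set (pawalk_verts v q)"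
    using r by (metis set_rev set_subset_Cons)
  have sub: "set (pawalk_verts u p) \<subseteq> carrier P" "set (pawalk_verts v q) \<subseteq> carrier P"
    using p(1) q(1) by (auto simp: cg.apath_def elim!: cg.awalkE')
  have disj: "set (pawalk_verts u p) \<inter> set r = {}"
  proof (rule ccontr)
    assume "set (pawalk_verts u p) \<inter> set r \<noteq> {}"
    then obtain c where c: "c \<in> set (pawalk_verts u p)" "c \<in> set r" by blast
    then have "u \<sqsubseteq> c" "c \<sqsubseteq> w" "v \<sqsubseteq> c" "c \<in> carrier P"
      using p(2) q(2) r_sub sub by auto
    then have "c = w" using least w(1) by (auto intro: le_antisym)
    then show False using c(2) distinct_r(2) by simp
  qed
  have x_notin: "x \<notin> set (pawalk_verts u p)" "x \<notin> set r"
    using p(2) q(2) r_sub carr above le_antisym by blast+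
  let ?c = "(x, u) # p @ rev_path q @ [(v, x)]"
  have tail: "cg.awalk v [(v, x)] x"
    using assms(2) carr by (simp add: cg.awalk_simps parcs_cover_graph)
  have return_walk: "cg.awalk w (rev_path q @ [(v, x)]) x"
    by (rule cg.awalk_appendI[OF walks(2) tail])
  have walk: "cg.awalk u (p @ rev_path q @ [(v, x)]) x"
    by (rule cg.awalk_appendI[OF walks(1) return_walk])
  have "pawalk_verts u (p @ rev_path q @ [(v, x)]) = pawalk_verts u p @ r @ [x]"
    using cg.awalk_verts_append[OF walk] cg.awalk_verts_append[OF return_walk]
      cg.awlast_of_awalk[OF walks(1)] cg.awlast_of_awalk[OF walks(2)] verts_q r
    by simp
  moreover have "distinct (pawalk_verts u p)" using p(1) by (simp add: cg.apath_def)
  \<comment> \<open>Only the base vertex of a cycle may recur, whence the \<open>tl\<close>; in this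
    tail \<open>x\<close> stands once, at the end.\<close>
  ultimately have "distinct (tl (pawalk_verts x ?c))"
    using disj distinct_r x_notin by auto
  moreover have "cg.awalk x ?c x"
    using walk assms(1) by (simp add: cg.awalk_Cons_iff parcs_cover_graph del: cg.awalk_append_iff)
  ultimately have "cg.cycle ?c"
    unfolding cg.cycle_def by blast
  \<comment> \<open>Two empty paths would give \<open>u = w = v\<close>. One arc besides the two at
    \<open>x\<close> makes three.\<close>
  moreover have "p \<noteq> [] \<or> q \<noteq> []"
    using walks assms(3) by (auto simp: cg.awalk_Nil_iff)
  then have "length ?c \<ge> 3"
    by (cases p; cases "rev_path q") auto
  ultimately show ?thesis by blast
qed

text \<open>Length at least 3 makes the predecessor and the successor of a minimal vertex of the
  cycle distinct. By minimality neither lies below it, so both cover it, against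
  \<open>unique\<close>.\<close>

lemma acyclic_cover_graph:
  assumes unique: "\<And>x u v. covers P u x \<Longrightarrow> covers P v x \<Longrightarrow> u = v"
    and p: "cg.cycle p" "length p \<ge> 3"
  shows False
proof -
  obtain s where walk: "cg.awalk s p s" and dist: "distinct (tl (pawalk_verts s p))"
    using p(1) by (auto simp: cg.cycle_def)
  have cas: "pcas s p s" and arcs: "set p \<subseteq> parcs (cover_graph P)"
    using walk by auto
  define n where "n = length p"
  have n: "n \<ge> 3" using p(2) by (simp add: n_def)
  have "tl (pawalk_verts s p) = map snd p"
    using cg.awalk_verts_conv'[OF cas] p(2) by (auto split: if_splits)
  with dist have dist_snd: "distinct (map snd p)" by simp
  have fst0: "fst (p ! 0) = s" using cas p(2) by (cases p) auto
  \<comment> \<open>Positions count modulo \<open>n\<close>: the last arc returns to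
    \<open>s\<close>, the tail of arc 0.\<close>
  have step: "snd (p ! i) = fst (p ! (Suc i mod n))" if "i < n" for i
    using pcas_nth[OF cas, of i] that fst0
    by (cases "Suc i = n") (auto simp: n_def)
  have edge: "covers P (fst (p ! i)) (snd (p ! i)) \<or> covers P (snd (p ! i)) (fst (p ! i))"
    if "i < n" for i
    using subsetD[OF arcs nth_mem[of i p]] that
      parcs_cover_graph[of "fst (p ! i)" "snd (p ! i)"]
    by (simp add: n_def)
  let ?A = "set (map snd p)"
  have "?A \<subseteq> carrier P"
    using arcs by (auto simp: cover_graph_def)
  moreover have "?A \<noteq> {}" using p(2) by auto
  ultimately obtain m where m: "m \<in> ?A" and min: "\<And>y. y \<in> ?A \<Longrightarrow> y \<sqsubseteq> m \<Longrightarrow> y = m"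
    using ex_minimal by metis
  then obtain i where i: "i < n" "snd (p ! i) = m"
    by (auto simp: in_set_conv_nth n_def)
  \<comment> \<open>Arc \<open>i\<close> enters \<open>m\<close>, arc \<open>j\<close> leaves it and
    arc \<open>k\<close> precedes \<open>i\<close>, so the neighbours of \<open>m\<close> on the
    cycle are the heads of \<open>j\<close> and \<open>k\<close>. The case split for
    \<open>k\<close> is there because \<open>i - 1\<close> truncates at 0.\<close>
  define j where "j = Suc i mod n"
  have j: "j < n" "fst (p ! j) = m" using step i n by (auto simp: j_def)
  define k where "k = (if i = 0 then n - 1 else i - 1)"
  have k: "k < n" "Suc k mod n = i" using i n by (auto simp: k_def)
  then have k': "snd (p ! k) = fst (p ! i)" using step by simp
  \<comment> \<open>For \<open>n = 2\<close> the two would coincide; from 3 on they differ.\<close>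
  have "j \<noteq> k"
    using i n by (cases "Suc i = n") (auto simp: j_def k_def split: if_splits)
  then have neq: "snd (p ! j) \<noteq> snd (p ! k)"
    using dist_snd j k by (auto simp: distinct_conv_nth n_def)
  have upper: "covers P y m" if "y \<in> ?A" "covers P m y \<or> covers P y m" for y
    using that min by (auto simp: covers_def lless_iff)
  have "covers P (snd (p ! j)) m"
    using upper[of "snd (p ! j)"] edge[OF j(1)] j by (auto simp: n_def)
  moreover have "covers P (snd (p ! k)) m"
    using upper[of "snd (p ! k)"] edge[OF i(1)] i(2) k(1) k' nth_mem[of k p]
    by (metis image_eqI list.set_map n_def)
  ultimately show False using unique neq by blast
qed

end

section \<open>Adjuncts of chains\<close>

text \<open>\<open>z\<close> plays the part of the least element. It is a parameter so that one
  fixed element serves all stages of an adjunct construction.\<close>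

definition upper_sets_chains_except :: "'a gorder \<Rightarrow> 'a \<Rightarrow> bool" where
  "upper_sets_chains_except P z \<longleftrightarrow>
     (\<forall>x\<in>carrier P - {z}. \<forall>y\<in>carrier P. \<forall>y'\<in>carrier P.
        x \<sqsubseteq>\<^bsub>P\<^esub> y \<longrightarrow> x \<sqsubseteq>\<^bsub>P\<^esub> y' \<longrightarrow> y \<sqsubseteq>\<^bsub>P\<^esub> y' \<or> y' \<sqsubseteq>\<^bsub>P\<^esub> y)"

lemma upper_sets_chains_exceptD:
  assumes "upper_sets_chains_except P z" "x \<in> carrier P" "x \<noteq> z"
    "y \<in> carrier P" "y' \<in> carrier P" "x \<sqsubseteq>\<^bsub>P\<^esub> y" "x \<sqsubseteq>\<^bsub>P\<^esub> y'"
  shows "y \<sqsubseteq>\<^bsub>P\<^esub> y' \<or> y' \<sqsubseteq>\<^bsub>P\<^esub> y"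
  using assms by (auto simp: upper_sets_chains_except_def)

lemma subposet_simps [simp]:
  "carrier (subposet P A) = A"
  "eq (subposet P A) = eq P"
  "le (subposet P A) = le P"
  "x \<sqsubset>\<^bsub>subposet P A\<^esub> y \<longleftrightarrow> x \<sqsubset>\<^bsub>P\<^esub> y"
  by (auto simp: subposet_def lless_def)

lemma partial_order_subposet:
  assumes "partial_order P" "A \<subseteq> carrier P"
  shows "partial_order (subposet P A)"
proof -
  interpret P: partial_order P by fact
  show ?thesis
    using assms(2) by unfold_locales (auto simp: P.eq_is_equal intro: P.le_trans P.le_antisym)
qed

section \<open>The order of a single adjunct\<close>

lemma carrier_adjunct [simp]: "carrier (adjunct L a b C) = carrier L \<union> carrier C"
  and eq_adjunct [simp]: "eq (adjunct L a b C) = (=)"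
  by (simp_all add: adjunct_def)

lemma le_adjunct:
  "x \<sqsubseteq>\<^bsub>adjunct L a b C\<^esub> y \<longleftrightarrow>
     (x \<in> carrier L \<and> y \<in> carrier L \<and> x \<sqsubseteq>\<^bsub>L\<^esub> y)
   \<or> (x \<in> carrier C \<and> y \<in> carrier C \<and> x \<sqsubseteq>\<^bsub>C\<^esub> y)
   \<or> (x \<in> carrier L \<and> y \<in> carrier C \<and> x \<sqsubseteq>\<^bsub>L\<^esub> a)
   \<or> (x \<in> carrier C \<and> y \<in> carrier L \<and> b \<sqsubseteq>\<^bsub>L\<^esub> y)"
  by (simp add: adjunct_def)

lemma le_adjunct_left:
  assumes "carrier L \<inter> carrier C = {}" "x \<in> carrier L" "y \<in> carrier L"
  shows "x \<sqsubseteq>\<^bsub>adjunct L a b C\<^esub> y \<longleftrightarrow> x \<sqsubseteq>\<^bsub>L\<^esub> y"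
  using assms by (auto simp: le_adjunct)

text \<open>The mixed cases rest on \<open>a\<close> being strictly below \<open>b\<close>: a detour
  from \<open>L\<close> through \<open>C\<close> back to \<open>L\<close> passes through
  \<open>a\<close> and \<open>b\<close> (\<open>between\<close>), while one from \<open>C\<close>
  through \<open>L\<close> back to \<open>C\<close> would put an element above \<open>b\<close> and
  below \<open>a\<close> (\<open>absurd\<close>).\<close>

lemma partial_order_adjunct:
  assumes "partial_order L" "partial_order C" and disj: "carrier L \<inter> carrier C = {}"
    and ab: "a \<in> carrier L" "b \<in> carrier L" "a \<sqsubset>\<^bsub>L\<^esub> b"
  shows "partial_order (adjunct L a b C)"
proof -
  interpret L: partial_order L by fact
  interpret C: partial_order C by fact
  have ab': "a \<sqsubseteq>\<^bsub>L\<^esub> b" "\<not> b \<sqsubseteq>\<^bsub>L\<^esub> a"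
    using ab L.le_antisym by (auto simp: lless_def L.eq_is_equal)
  have between: "x \<sqsubseteq>\<^bsub>L\<^esub> y" if "x \<in> carrier L" "y \<in> carrier L" "x \<sqsubseteq>\<^bsub>L\<^esub> a" "b \<sqsubseteq>\<^bsub>L\<^esub> y" for x y
    using that ab ab' by (meson L.le_trans)
  have absurd: False if "x \<in> carrier L" "x \<sqsubseteq>\<^bsub>L\<^esub> a" "b \<sqsubseteq>\<^bsub>L\<^esub> x" for x
    using that ab ab' by (meson L.le_trans)
  show ?thesis
  proof unfold_locales
    fix x y
    assume "x \<sqsubseteq>\<^bsub>adjunct L a b C\<^esub> y" "y \<sqsubseteq>\<^bsub>adjunct L a b C\<^esub> x"
      "x \<in> carrier (adjunct L a b C)" "y \<in> carrier (adjunct L a b C)"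
    then show "x .=\<^bsub>adjunct L a b C\<^esub> y"
      using disj by (auto simp: le_adjunct dest: absurd intro: L.le_antisym C.le_antisym)
  next
    fix x y z
    assume *: "x \<sqsubseteq>\<^bsub>adjunct L a b C\<^esub> y" "y \<sqsubseteq>\<^bsub>adjunct L a b C\<^esub> z"
      "x \<in> carrier (adjunct L a b C)" "y \<in> carrier (adjunct L a b C)"
      "z \<in> carrier (adjunct L a b C)"
    have not_C: "x \<notin> carrier C" if "x \<in> carrier L" for x
      using that disj by blast
    show "x \<sqsubseteq>\<^bsub>adjunct L a b C\<^esub> z"
      using *(1,2) ab(1,2) C.le_trans[of x y z] L.le_trans[of x y z] L.le_trans[of x y a]
        L.le_trans[of b y z]
        between[of x z] absurd[of y] not_C[of x] not_C[of y] not_C[of z]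
      unfolding le_adjunct by argo
  qed (auto simp: le_adjunct)
qed

section \<open>Invariants of adjuncts of chains\<close>

lemma partial_order_adjunct_of_chains:
  "adjunct_of_chains M ps \<Longrightarrow> partial_order M"
proof (induction rule: adjunct_of_chains.induct)
  case (chain C)
  then show ?case by (simp add: finite_chain_def total_order_def)
next
  case (adjunct L ps C a b)
  then show ?case
    by (intro partial_order_adjunct) (auto simp: finite_chain_def total_order_def)
qed

text \<open>Since only \<open>z\<close> itself lies below \<open>z\<close>, no other old element
  gets new elements above it. Above a member of the new chain lie only members of that chain and the
  old elements above \<open>b\<close>, which form a chain by induction because \<open>b\<close>
  differs from \<open>z\<close>.\<close>

lemma upper_sets_chains_adjunct_of_chains:
  assumes "adjunct_of_chains M ps" "\<forall>(a, b)\<in>set ps. a = z"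
    "\<And>x. x \<in> carrier M \<Longrightarrow> x \<sqsubseteq>\<^bsub>M\<^esub> z \<Longrightarrow> x = z"
  shows "upper_sets_chains_except M z"
  using assms
proof (induction rule: adjunct_of_chains.induct)
  case (chain C)
  then show ?case
    by (auto simp: upper_sets_chains_except_def finite_chain_def dest: total_order.total_order_total)
next
  case (adjunct L ps C a b)
  interpret C: total_order C using adjunct.hyps by (simp add: finite_chain_def)
  interpret L: partial_order L
    using adjunct.hyps(1) by (rule partial_order_adjunct_of_chains)
  let ?M = "adjunct L a b C"
  have az: "a = z" and ps: "\<forall>(a, b)\<in>set ps. a = z"
    using adjunct.prems(1) by auto
  have least: "x = z" if "x \<in> carrier L" "x \<sqsubseteq>\<^bsub>L\<^esub> z" for x
    using that adjunct.prems(2)[of x] adjunct.hyps az by (simp add: le_adjunct_left)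
  have IH: "upper_sets_chains_except L z"
    using adjunct.IH[OF ps] least by blast
  have bz: "b \<noteq> z" using adjunct.hyps az by (auto simp: lless_def L.eq_is_equal)
  show ?case
    unfolding upper_sets_chains_except_def
  proof (intro ballI impI)
    fix x y y'
    assume x: "x \<in> carrier ?M - {z}" and yy: "y \<in> carrier ?M" "y' \<in> carrier ?M"
      and le: "x \<sqsubseteq>\<^bsub>?M\<^esub> y" "x \<sqsubseteq>\<^bsub>?M\<^esub> y'"
    show "y \<sqsubseteq>\<^bsub>?M\<^esub> y' \<or> y' \<sqsubseteq>\<^bsub>?M\<^esub> y"
    proof (cases "x \<in> carrier L")
      case True
      then have "y \<in> carrier L" "y' \<in> carrier L" "x \<sqsubseteq>\<^bsub>L\<^esub> y" "x \<sqsubseteq>\<^bsub>L\<^esub> y'"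
        using le x least az adjunct.hyps(3) by (auto simp: le_adjunct)
      then show ?thesis
        using upper_sets_chains_exceptD[OF IH True] x by (auto simp: le_adjunct)
    next
      case False
      then have "y \<in> carrier C \<or> y \<in> carrier L \<and> b \<sqsubseteq>\<^bsub>L\<^esub> y"
        and "y' \<in> carrier C \<or> y' \<in> carrier L \<and> b \<sqsubseteq>\<^bsub>L\<^esub> y'"
        using le by (auto simp: le_adjunct)
      then show ?thesis
        using upper_sets_chains_exceptD[OF IH \<open>b \<in> carrier L\<close> bz, of y y'] C.total_order_total[of y y']
        by (auto simp: le_adjunct)
    qed
  qed
qed

text \<open>
  When the pair \<open>(a, b)\<close> is adjoined, \<open>a\<close> is the meet of any element of the new chain and any
  element strictly between \<open>a\<close> and \<open>b\<close>; later adjuncts do not destroy this.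
\<close>

lemma adjunct_pair_is_meet:
  assumes "adjunct_of_chains M ps" "(a, b) \<in> set ps"
  shows "\<exists>y\<in>carrier M. \<exists>c\<in>carrier M. a \<in> carrier M \<and> y \<noteq> a \<and> c \<noteq> a \<and> a \<sqsubseteq>\<^bsub>M\<^esub> y \<and> a \<sqsubseteq>\<^bsub>M\<^esub> c \<and>
    (\<forall>d\<in>carrier M. d \<sqsubseteq>\<^bsub>M\<^esub> y \<longrightarrow> d \<sqsubseteq>\<^bsub>M\<^esub> c \<longrightarrow> d \<sqsubseteq>\<^bsub>M\<^esub> a)"
  using assms
proof (induction rule: adjunct_of_chains.induct)
  case (adjunct L ps C a' b')
  interpret L: partial_order L
    using adjunct.hyps(1) by (rule partial_order_adjunct_of_chains)
  let ?M = "adjunct L a' b' C"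
  show ?case
  proof (cases "(a, b) \<in> set ps")
    case True
    then obtain y c where yc: "y \<in> carrier L" "c \<in> carrier L" "a \<in> carrier L" "y \<noteq> a" "c \<noteq> a"
      "a \<sqsubseteq>\<^bsub>L\<^esub> y" "a \<sqsubseteq>\<^bsub>L\<^esub> c" "\<And>d. d \<in> carrier L \<Longrightarrow> d \<sqsubseteq>\<^bsub>L\<^esub> y \<Longrightarrow> d \<sqsubseteq>\<^bsub>L\<^esub> c \<Longrightarrow> d \<sqsubseteq>\<^bsub>L\<^esub> a"
      using adjunct.IH by blast
    \<comment> \<open>A member of the new chain below both \<open>y\<close> and \<open>c\<close> has
      \<open>b'\<close> below both, hence \<open>b'\<close> below \<open>a\<close>, and so lies
      below \<open>a\<close> itself.\<close>
    have "d \<sqsubseteq>\<^bsub>?M\<^esub> a" if "d \<sqsubseteq>\<^bsub>?M\<^esub> y" "d \<sqsubseteq>\<^bsub>?M\<^esub> c" for d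
      using that yc adjunct.hyps by (auto simp: le_adjunct)
    moreover have "a \<sqsubseteq>\<^bsub>?M\<^esub> y" "a \<sqsubseteq>\<^bsub>?M\<^esub> c"
      using yc by (auto simp: le_adjunct)
    ultimately show ?thesis
      using yc by (intro bexI[of _ y] bexI[of _ c]) auto
  next
    case False
    then have ab: "a = a'" "b = b'" using adjunct.prems by auto
    obtain y where y: "y \<in> carrier L" "a \<sqsubset>\<^bsub>L\<^esub> y" "y \<sqsubset>\<^bsub>L\<^esub> b"
      using adjunct.hyps ab by (auto simp: covers_def)
    obtain c where c: "c \<in> carrier C"
      using adjunct.hyps(2) by (auto simp: finite_chain_def)
    \<comment> \<open>This keeps the new chain from lying below \<open>y\<close>: common lower
      bounds of \<open>y\<close> and \<open>c\<close> are old elements, and being below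
      \<open>c\<close> they are below \<open>a\<close>.\<close>
    have "\<not> b \<sqsubseteq>\<^bsub>L\<^esub> y"
      using y adjunct.hyps ab L.le_antisym by (auto simp: lless_def L.eq_is_equal)
    then have "d \<sqsubseteq>\<^bsub>?M\<^esub> a" if "d \<sqsubseteq>\<^bsub>?M\<^esub> y" "d \<sqsubseteq>\<^bsub>?M\<^esub> c" for d
      using that y c ab adjunct.hyps by (auto simp: le_adjunct)
    moreover have "a \<sqsubseteq>\<^bsub>?M\<^esub> y" "a \<sqsubseteq>\<^bsub>?M\<^esub> c" "y \<noteq> a" "c \<noteq> a"
      using y c ab adjunct.hyps by (auto simp: le_adjunct lless_def L.eq_is_equal)
    ultimately show ?thesis
      using y c ab adjunct.hyps by (intro bexI[of _ y] bexI[of _ c]) auto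
  qed
qed simp

section \<open>The equivalences\<close>

locale nonempty_finite_lattice = finite_poset L + lattice L for L :: "'a gorder" (structure) +
  assumes carrier_nonempty: "carrier L \<noteq> {}"
begin

section \<open>Bounds and meets in a finite lattice\<close>

text \<open>\<open>\<bottom>\<close> is a choice term, so a least element must be exhibited first:
  the infimum of the finite carrier.\<close>

lemma bottom_closed: "\<bottom> \<in> carrier L"
  and bottom_le: "x \<in> carrier L \<Longrightarrow> \<bottom> \<sqsubseteq> x"
proof -
  have "greatest L (\<Sqinter>carrier L) (Lower L (carrier L))"
    using finite_carrier carrier_nonempty by (intro finite_inf_greatest) auto
  then have "least L (\<Sqinter>carrier L) (carrier L)"
    by (auto simp: greatest_def least_def Lower_def)
  then have "least L \<bottom> (carrier L)"
    unfolding bottom_def by (rule someI)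
  then show "\<bottom> \<in> carrier L" "x \<in> carrier L \<Longrightarrow> \<bottom> \<sqsubseteq> x"
    by (auto simp: least_def)
qed

lemma top_closed: "\<top> \<in> carrier L"
  and top_ge: "x \<in> carrier L \<Longrightarrow> x \<sqsubseteq> \<top>"
proof -
  have "least L (\<Squnion>carrier L) (Upper L (carrier L))"
    using finite_carrier carrier_nonempty by (intro finite_sup_least) auto
  then have "greatest L (\<Squnion>carrier L) (carrier L)"
    by (auto simp: greatest_def least_def Upper_def)
  then have "greatest L \<top> (carrier L)"
    unfolding top_def by (rule someI)
  then show "\<top> \<in> carrier L" "x \<in> carrier L \<Longrightarrow> x \<sqsubseteq> \<top>"
    by (auto simp: greatest_def)
qed

lemma bottom_unique: "x \<in> carrier L \<Longrightarrow> x \<sqsubseteq> \<bottom> \<Longrightarrow> x = \<bottom>"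
  by (rule le_antisym) (simp_all add: bottom_closed bottom_le)

lemma meet_eqI:
  assumes "a \<in> carrier L" "y \<in> carrier L" "z \<in> carrier L" "a \<sqsubseteq> y" "a \<sqsubseteq> z"
    "\<And>d. d \<in> carrier L \<Longrightarrow> d \<sqsubseteq> y \<Longrightarrow> d \<sqsubseteq> z \<Longrightarrow> d \<sqsubseteq> a"
  shows "y \<sqinter> z = a"
  by (rule le_antisym) (use assms in \<open>simp_all add: meet_left meet_right meet_le\<close>)

lemma meet_absorb_left: "x \<in> carrier L \<Longrightarrow> y \<in> carrier L \<Longrightarrow> x \<sqsubseteq> y \<Longrightarrow> x \<sqinter> y = x"
  by (intro meet_eqI) auto

section \<open>The chain condition and meet-irreducibility\<close>

abbreviation "chain_condition \<equiv> upper_sets_chains_except L \<bottom>"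

text \<open>With \<open>chain_conditionD\<close> this recasts the condition as: incomparable
  elements meet in \<open>\<bottom>\<close>. A nonzero common lower bound lies below the meet, which
  is then nonzero.\<close>

lemma not_chain_conditionE:
  assumes "\<not> chain_condition"
  obtains y z where "y \<in> carrier L" "z \<in> carrier L" "\<not> y \<sqsubseteq> z" "\<not> z \<sqsubseteq> y" "y \<sqinter> z \<noteq> \<bottom>"
proof -
  from assms obtain x y z where *: "x \<in> carrier L" "x \<noteq> \<bottom>" "y \<in> carrier L" "z \<in> carrier L"
      "x \<sqsubseteq> y" "x \<sqsubseteq> z" "\<not> y \<sqsubseteq> z" "\<not> z \<sqsubseteq> y"
    by (auto simp: upper_sets_chains_except_def)
  moreover from * have "x \<sqsubseteq> y \<sqinter> z" by (intro meet_le)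
  ultimately show thesis using that bottom_unique by metis
qed

lemma chain_conditionD:
  assumes chain_condition "y \<in> carrier L" "z \<in> carrier L" "y \<sqinter> z \<noteq> \<bottom>"
  shows "y \<sqsubseteq> z \<or> z \<sqsubseteq> y"
  using upper_sets_chains_exceptD[OF assms(1) _ assms(4,2,3)] assms
  by (simp add: meet_left meet_right)

text \<open>The meet of two elements differs from both exactly when they are incomparable.\<close>

lemma meet_irreducible_iff_chain_condition:
  "(\<forall>x\<in>carrier L - {\<bottom>}. meet_irreducible L x) \<longleftrightarrow> chain_condition"
proof
  assume irr: "\<forall>x\<in>carrier L - {\<bottom>}. meet_irreducible L x"
  show chain_condition
  proof (rule ccontr)
    assume "\<not> chain_condition"
    then obtain y z where yz: "y \<in> carrier L" "z \<in> carrier L" "\<not> y \<sqsubseteq> z" "\<not> z \<sqsubseteq> y" "y \<sqinter> z \<noteq> \<bottom>"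
      by (rule not_chain_conditionE)
    then have "y \<noteq> y \<sqinter> z" "z \<noteq> y \<sqinter> z"
      using meet_left[of y z] meet_right[of y z] by metis+
    with yz have "meet_reducible L (y \<sqinter> z)"
      unfolding meet_reducible_def by (intro conjI bexI[of _ y] bexI[of _ z]) auto
    with irr yz show False by (simp add: meet_irreducible_def)
  qed
next
  assume cc: chain_condition
  have False if "x \<noteq> \<bottom>" "meet_reducible L x" for x
  proof -
    from that(2) obtain y z where yz: "y \<in> carrier L" "z \<in> carrier L" "y \<noteq> x" "z \<noteq> x" "x = y \<sqinter> z"
      by (auto simp: meet_reducible_def)
    with chain_conditionD[OF cc, of y z] that(1) have "y \<sqsubseteq> z \<or> z \<sqsubseteq> y" by simp
    with yz show False
      using meet_absorb_left[of y z] meet_absorb_left[of z y] by (auto simp: meet_comm)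
  qed
  then show "\<forall>x\<in>carrier L - {\<bottom>}. meet_irreducible L x"
    by (auto simp: meet_irreducible_def)
qed

section \<open>Building an adjunct representation from the atoms\<close>

definition atoms :: "'a set" where
  "atoms = {p \<in> carrier L - {\<bottom>}. \<forall>x\<in>carrier L. x \<sqsubseteq> p \<longrightarrow> x = \<bottom> \<or> x = p}"

text \<open>The stages of the adjunct construction, ending with \<open>span atoms\<close>.
  \<open>\<bottom>\<close> is put in as the point at which every new chain is attached.\<close>

definition span :: "'a set \<Rightarrow> 'a set" where
  "span A = insert \<bottom> {x \<in> carrier L. \<exists>p\<in>A. p \<sqsubseteq> x}"

lemma atom_below:
  assumes "x \<in> carrier L" "x \<noteq> \<bottom>"
  obtains p where "p \<in> atoms" "p \<sqsubseteq> x"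
proof -
  let ?A = "{y \<in> carrier L. y \<noteq> \<bottom> \<and> y \<sqsubseteq> x}"
  have "x \<in> ?A" using assms by simp
  then obtain p where p: "p \<in> ?A" and min: "\<And>y. y \<in> ?A \<Longrightarrow> y \<sqsubseteq> p \<Longrightarrow> y = p"
    using ex_minimal[of ?A] by blast
  have "y = \<bottom> \<or> y = p" if "y \<in> carrier L" "y \<sqsubseteq> p" for y
    using that p assms(1) min[of y] le_trans[of y p x] by auto
  with p have "p \<in> atoms" by (simp add: atoms_def)
  then show thesis using p that by simp
qed

lemma span_atoms: "span atoms = carrier L"
proof
  show "carrier L \<subseteq> span atoms"
  proof
    fix x assume "x \<in> carrier L"
    then show "x \<in> span atoms"
      by (cases "x = \<bottom>") (auto simp: span_def elim: atom_below)
  qed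
qed (auto simp: span_def bottom_closed)

lemma span_subset: "span A \<subseteq> carrier L"
  using bottom_closed by (auto simp: span_def)

lemma span_upward_closed:
  assumes "A \<subseteq> carrier L" "x \<in> span A" "x \<noteq> \<bottom>" "y \<in> carrier L" "x \<sqsubseteq> y"
  shows "y \<in> span A"
proof -
  obtain p where "p \<in> A" "p \<sqsubseteq> x" "x \<in> carrier L"
    using assms(2,3) by (auto simp: span_def)
  moreover from this have "p \<sqsubseteq> y"
    using assms(1,4,5) by (intro le_trans[of p x y]) auto
  ultimately show ?thesis
    using assms(4) by (auto simp: span_def)
qed

lemma finite_chain_subposet:
  assumes "A \<subseteq> carrier L" "A \<noteq> {}"
    "\<And>x y. x \<in> A \<Longrightarrow> y \<in> A \<Longrightarrow> x \<sqsubseteq> y \<or> y \<sqsubseteq> x"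
  shows "finite_chain (subposet L A)"
proof -
  interpret A: partial_order "subposet L A"
    using partial_order_axioms assms(1) by (rule partial_order_subposet)
  have "total_order (subposet L A)"
    by (rule A.total_orderI) (use assms(3) in simp)
  then show ?thesis
    using assms(1,2) finite_carrier by (auto simp: finite_chain_def intro: finite_subset)
qed

text \<open>
  Adding one more atom \<open>p\<close> to \<open>A\<close> amounts to an adjunct with the chain of all elements above
  \<open>p\<close> not yet present. The least element \<open>b\<close> above \<open>p\<close> that is already present does not cover
  \<open>\<bottom>\<close>, because some other atom in \<open>A\<close> lies below it.
\<close>

lemma adjunct_representation_span:
  assumes cc: chain_condition and "finite A" "A \<noteq> {}" "A \<subseteq> atoms"
  shows "\<exists>ps. adjunct_representation (subposet L (span A)) ps"
  using assms(2-4)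
proof (induction A rule: finite_ne_induct)
  case (singleton p)
  then have p: "p \<in> carrier L" "p \<noteq> \<bottom>" by (auto simp: atoms_def)
  have "x \<sqsubseteq> y \<or> y \<sqsubseteq> x" if "x \<in> span {p}" "y \<in> span {p}" for x y
    using that upper_sets_chains_exceptD[OF cc p, of x y] bottom_le bottom_closed
    by (auto simp: span_def)
  then have "finite_chain (subposet L (span {p}))"
    using span_subset by (intro finite_chain_subposet) (auto simp: span_def)
  then have "adjunct_of_chains (subposet L (span {p})) []"
    by (rule adjunct_of_chains.chain)
  then have "adjunct_representation (subposet L (span {p})) []"
    unfolding adjunct_representation_def same_poset_def by blast
  then show ?case ..
next
  case (insert p A)
  have p: "p \<in> carrier L" "p \<noteq> \<bottom>"
    and p_atom: "\<And>x. x \<in> carrier L \<Longrightarrow> x \<sqsubseteq> p \<Longrightarrow> x = \<bottom> \<or> x = p"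
    using insert.prems by (auto simp: atoms_def)
  have A: "A \<subseteq> carrier L" "\<bottom> \<notin> A" using insert.prems by (auto simp: atoms_def)
  obtain M ps where M: "adjunct_of_chains M ps" "carrier M = span A"
    and le_M: "\<And>x y. x \<in> span A \<Longrightarrow> y \<in> span A \<Longrightarrow> x \<sqsubseteq>\<^bsub>M\<^esub> y \<longleftrightarrow> x \<sqsubseteq> y"
    using insert.IH insert.prems by (auto simp: adjunct_representation_def same_poset_def)
  interpret M: partial_order M
    using M(1) by (rule partial_order_adjunct_of_chains)
  have p_notin: "p \<notin> span A"
    using insert.hyps(3) p(2) p_atom A by (auto simp: span_def)
  define K where "K = {y \<in> carrier L. p \<sqsubseteq> y \<and> y \<notin> span A}"
  have chain_p: "x \<sqsubseteq> y \<or> y \<sqsubseteq> x" if "x \<in> carrier L" "y \<in> carrier L" "p \<sqsubseteq> x" "p \<sqsubseteq> y" for x y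
    using upper_sets_chains_exceptD[OF cc p] that by blast
  have chain_K: "finite_chain (subposet L K)"
    using p p_notin chain_p by (intro finite_chain_subposet) (auto simp: K_def)
  let ?B = "{y \<in> carrier L. p \<sqsubseteq> y \<and> y \<in> span A}"
  \<comment> \<open>Here \<open>A\<close> being nonempty matters: \<open>\<top>\<close> lies above
    one of its atoms.\<close>
  have "\<top> \<in> ?B"
    using insert.hyps(2) A p top_closed top_ge by (auto simp: span_def)
  then obtain b where b: "b \<in> ?B" and min: "\<And>y. y \<in> ?B \<Longrightarrow> y \<sqsubseteq> b \<Longrightarrow> y = b"
    using ex_minimal[of ?B] by blast
  \<comment> \<open>Minimal means least here, as everything above \<open>p\<close> is pairwise
    comparable.\<close>
  have b_least: "b \<sqsubseteq> y" if "y \<in> ?B" for y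
    using chain_p[of b y] min[OF that] that b by auto
  have b_bot: "b \<noteq> \<bottom>" using b bottom_unique[of p] p by auto
  have bot_M: "\<bottom> \<in> carrier M" by (simp add: M(2) span_def)
  have b_M: "b \<in> carrier M" using b M(2) by simp
  have lless_M: "x \<sqsubset>\<^bsub>M\<^esub> y \<longleftrightarrow> x \<sqsubseteq> y \<and> x \<noteq> y" if "x \<in> span A" "y \<in> span A" for x y
    using le_M[OF that] by (simp add: lless_def M.eq_is_equal)
  have bot_b: "\<bottom> \<sqsubset>\<^bsub>M\<^esub> b"
    using lless_M[of "\<bottom>" b] bot_M b_M M(2) b b_bot bottom_le by auto
  have "\<not> covers M b \<bottom>"
  proof -
    obtain q where q: "q \<in> A" "q \<sqsubseteq> b" "q \<in> carrier L" using b b_bot A by (auto simp: span_def)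
    have "q \<noteq> b"
    proof
      assume "q = b"
      then have "p = q" using q b p insert.prems by (auto simp: atoms_def)
      then show False using q insert.hyps(3) by simp
    qed
    moreover have "q \<in> span A" using q by (auto simp: span_def)
    moreover have "q \<noteq> \<bottom>" using q A by auto
    ultimately have "\<bottom> \<sqsubset>\<^bsub>M\<^esub> q" "q \<sqsubset>\<^bsub>M\<^esub> b"
      using q lless_M bot_M b_M M(2) bottom_le by auto
    with \<open>q \<in> span A\<close> show ?thesis using M(2) by (auto simp: covers_def)
  qed
  then have "adjunct_of_chains (adjunct M \<bottom> b (subposet L K)) (ps @ [(\<bottom>, b)])"
    using M chain_K bot_M b_M bot_b by (intro adjunct_of_chains.adjunct) (auto simp: K_def)
  moreover have "same_poset (subposet L (span (insert p A))) (adjunct M \<bottom> b (subposet L K))"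
    unfolding same_poset_def
  proof (intro conjI ballI)
    have union: "span (insert p A) = span A \<union> K"
      by (auto simp: span_def K_def)
    then show "carrier (subposet L (span (insert p A))) =
        carrier (adjunct M \<bottom> b (subposet L K))"
      by (simp add: M(2))
    \<comment> \<open>Apart from \<open>\<bottom>\<close>, \<open>span A\<close> is closed upwards,
      so only \<open>\<bottom>\<close> lies below a member of \<open>K\<close>. The right-hand side
      has the form of the adjunct clause with \<open>a = \<bottom>\<close>.\<close>
    have span_K: "x \<sqsubseteq> y \<longleftrightarrow> x \<sqsubseteq> \<bottom>" if "x \<in> span A" "y \<in> K" for x y
    proof -
      have "x \<sqsubseteq> y \<longleftrightarrow> x = \<bottom>"
        using that span_upward_closed[OF A(1) that(1), of y] bottom_le by (auto simp: K_def)
      then show ?thesis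
        using that span_subset bottom_unique bottom_closed by blast
    qed
    \<comment> \<open>Old elements above \<open>x\<close> are above \<open>p\<close>, hence above
      \<open>b\<close>. Conversely \<open>x\<close> and \<open>b\<close> are comparable, and
      \<open>b\<close> below \<open>x\<close> would put \<open>x\<close> into \<open>span A\<close>;
      so \<open>x\<close> lies below \<open>b\<close>.\<close>
    have K_span: "x \<sqsubseteq> y \<longleftrightarrow> b \<sqsubseteq> y" if "x \<in> K" "y \<in> span A" for x y
    proof
      have carr: "x \<in> carrier L" "y \<in> carrier L" "p \<sqsubseteq> x" "x \<notin> span A"
        using that span_subset by (auto simp: K_def)
      {
        assume "x \<sqsubseteq> y"
        with carr p have "p \<sqsubseteq> y" by (meson le_trans)
        then show "b \<sqsubseteq> y" using b_least carr that by simp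
      next
        assume "b \<sqsubseteq> y"
        moreover have "\<not> b \<sqsubseteq> x"
          using span_upward_closed[OF A(1) _ b_bot carr(1)] b carr(4) by blast
        then have "x \<sqsubseteq> b" using chain_p[of x b] carr b by auto
        ultimately show "x \<sqsubseteq> y" using carr b le_trans by blast
      }
    qed
    fix x y
    assume "x \<in> carrier (subposet L (span (insert p A)))"
      "y \<in> carrier (subposet L (span (insert p A)))"
    moreover have "span A \<inter> K = {}" by (auto simp: K_def)
    ultimately show "x \<sqsubseteq>\<^bsub>subposet L (span (insert p A))\<^esub> y \<longleftrightarrow>
        x \<sqsubseteq>\<^bsub>adjunct M \<bottom> b (subposet L K)\<^esub> y"
      using union span_K K_span le_M b_M bot_M M(2) by (auto simp: le_adjunct)
  qed
  ultimately show ?case by (auto simp: adjunct_representation_def)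
qed

section \<open>Lower dismantlability\<close>

text \<open>If one element were below the other, their join would be the larger one, which is not
  \<open>\<top>\<close>.\<close>

lemma top_join_reducibleE:
  assumes "join_reducible L \<top>"
  obtains y z where "y \<in> carrier L" "z \<in> carrier L" "y \<noteq> \<top>" "z \<noteq> \<top>" "y \<squnion> z = \<top>"
    "\<not> y \<sqsubseteq> z" "\<not> z \<sqsubseteq> y"
proof -
  from assms obtain y z where yz: "y \<in> carrier L" "z \<in> carrier L" "y \<noteq> \<top>" "z \<noteq> \<top>" "y \<squnion> z = \<top>"
    by (auto simp: join_reducible_def)
  have "\<not> \<top> \<sqsubseteq> y" "\<not> \<top> \<sqsubseteq> z"
    using yz top_ge le_antisym top_closed by blast+
  then have "\<not> y \<sqsubseteq> z" "\<not> z \<sqsubseteq> y"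
    using yz join_le[of y z z] join_le[of y y z] by auto
  with yz show thesis by (intro that)
qed

lemma lower_dismantlable_iff_chain_condition:
  assumes "join_reducible L \<top>"
  shows "lower_dismantlable L \<longleftrightarrow> chain_condition"
proof
  from assms obtain y z where yz: "y \<in> carrier L" "z \<in> carrier L" "\<not> y \<sqsubseteq> z" "\<not> z \<sqsubseteq> y"
    by (rule top_join_reducibleE)
  assume "lower_dismantlable L"
  \<comment> \<open>The incomparable pair rules out the chain alternative, leaving the condition on
    adjunct pairs.\<close>
  moreover have "\<not> finite_chain L"
    using yz total_order.total_order_total[of L y z] by (auto simp: finite_chain_def)
  ultimately obtain ps where ps: "adjunct_representation L ps" "\<forall>(a, b)\<in>set ps. a = \<bottom>"
    by (auto simp: lower_dismantlable_def dismantlable_def adjunct_pairs_def)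
  then obtain M where M: "adjunct_of_chains M ps" "same_poset L M"
    by (auto simp: adjunct_representation_def)
  have "upper_sets_chains_except M \<bottom>"
    using M ps bottom_unique bottom_closed
    by (intro upper_sets_chains_adjunct_of_chains[OF M(1)]) (auto simp: same_poset_def)
  with M(2) show chain_condition
    by (auto simp: upper_sets_chains_except_def same_poset_def)
next
  assume cc: chain_condition
  have "atoms \<noteq> {}"
  proof -
    from assms obtain y where "y \<in> carrier L" "y \<noteq> \<top>"
      by (rule top_join_reducibleE)
    then show ?thesis
      using atom_below bottom_closed top_closed by (metis empty_iff)
  qed
  moreover have "finite atoms"
    using finite_carrier by (rule rev_finite_subset) (auto simp: atoms_def)
  ultimately obtain ps where "adjunct_representation (subposet L (carrier L)) ps"
    using adjunct_representation_span[OF cc, of atoms] span_atoms by auto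
  then have "dismantlable L"
    using finite_carrier carrier_nonempty lattice_axioms
    by (auto simp: dismantlable_def finite_lattice_def adjunct_representation_def same_poset_def)
  \<comment> \<open>\<open>adjunct_pairs\<close> collects the pairs of all representations, so an
    arbitrary one is treated, not just the one constructed above.\<close>
  moreover have "a = \<bottom>" if rep: "adjunct_representation L ps" and ab: "(a, b) \<in> set ps" for a b ps
  proof (rule ccontr)
    assume "a \<noteq> \<bottom>"
    from rep obtain M where M: "adjunct_of_chains M ps" and carr: "carrier M = carrier L"
      and le: "\<And>x y. x \<in> carrier L \<Longrightarrow> y \<in> carrier L \<Longrightarrow> x \<sqsubseteq>\<^bsub>M\<^esub> y \<longleftrightarrow> x \<sqsubseteq> y"
      by (auto simp: adjunct_representation_def same_poset_def)
    obtain y c where yc: "y \<in> carrier L" "c \<in> carrier L" "a \<in> carrier L" "y \<noteq> a" "c \<noteq> a"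
        "a \<sqsubseteq> y" "a \<sqsubseteq> c" "\<And>d. d \<in> carrier L \<Longrightarrow> d \<sqsubseteq> y \<Longrightarrow> d \<sqsubseteq> c \<Longrightarrow> d \<sqsubseteq> a"
      using adjunct_pair_is_meet[OF M ab] by (auto simp: carr le)
    then have "a = y \<sqinter> c" by (intro meet_eqI[symmetric])
    then have "meet_reducible L a" using yc by (auto simp: meet_reducible_def)
    with \<open>a \<noteq> \<bottom>\<close> cc yc(3) show False
      by (auto simp: meet_irreducible_iff_chain_condition[symmetric] meet_irreducible_def)
  qed
  ultimately show "lower_dismantlable L"
    by (auto simp: lower_dismantlable_def adjunct_pairs_def)
qed

section \<open>The cover graph of the nonzero elements\<close>

lemma cover_graph_tree_iff_chain_condition:
  assumes "\<bottom> \<noteq> \<top>"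
  shows "undirected_tree (cover_graph (subposet L (carrier L - {\<bottom>}))) \<longleftrightarrow> chain_condition"
proof -
  let ?N = "subposet L (carrier L - {\<bottom>})"
  interpret N: finite_poset ?N
  proof -
    interpret partial_order ?N
      using partial_order_axioms by (rule partial_order_subposet) auto
    show "finite_poset ?N"
      by unfold_locales (simp add: finite_carrier)
  qed
  \<comment> \<open>\<open>\<top>\<close> remains a vertex, so connectedness is automatic and only
    cycles decide.\<close>
  have conn: "connected (with_proj (cover_graph ?N))"
    using assms top_closed top_ge by (intro N.connected_cover_graph[of "\<top>"]) auto
  show ?thesis
  proof
    assume tree: "undirected_tree (cover_graph ?N)"
    show chain_condition
    proof (rule ccontr)
      assume "\<not> chain_condition"
      then obtain y z where yz: "y \<in> carrier L" "z \<in> carrier L" "\<not> y \<sqsubseteq> z" "\<not> z \<sqsubseteq> y" "y \<sqinter> z \<noteq> \<bottom>"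
        by (rule not_chain_conditionE)
      define x where "x = y \<sqinter> z"
      have x: "x \<in> carrier L" "x \<noteq> \<bottom>" "x \<sqsubseteq> y" "x \<sqsubseteq> z" "x \<noteq> y" "x \<noteq> z"
        using yz meet_left[of y z] meet_right[of y z] by (auto simp: x_def)
      have nonbot: "y \<noteq> \<bottom>" "z \<noteq> \<bottom>" using yz bottom_le by auto
      obtain u where u: "covers ?N u x" "u \<sqsubseteq> y"
        using N.covers_between[of x y] x yz nonbot by (auto simp: lless_iff)
      obtain v where v: "covers ?N v x" "v \<sqsubseteq> z"
        using N.covers_between[of x z] x yz nonbot by (auto simp: lless_iff)
      have uv: "u \<in> carrier L" "v \<in> carrier L" "u \<noteq> \<bottom>" "v \<noteq> \<bottom>" "x \<sqsubseteq> u" "x \<noteq> u"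
        using u(1) v(1) by (auto simp: covers_def lless_iff)
      \<comment> \<open>A common cover would lie below \<open>y\<close> and \<open>z\<close>, hence
        below their meet \<open>x\<close>.\<close>
      have "u \<noteq> v"
      proof
        assume "u = v"
        then have "u \<sqsubseteq> x" using u v uv yz meet_le[of u y z] by (simp add: x_def)
        then show False using x uv le_antisym by blast
      qed
      \<comment> \<open>The join has to lie in \<open>?N\<close> to serve as the least upper bound
        there.\<close>
      moreover have "u \<squnion> v \<noteq> \<bottom>"
        using uv join_left[of u v] bottom_unique[of u] by auto
      ultimately have "\<exists>p. N.cg.cycle p \<and> length p \<ge> 3"
        using u v uv by (intro N.cycle_of_two_covers[of u x v "u \<squnion> v"])
          (auto simp: join_left join_right join_le)
      with tree show False by (auto simp: undirected_tree_def)
    qed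
  next
    assume cc: chain_condition
    have "u = v" if "covers ?N u x" "covers ?N v x" for x u v
    proof -
      have *: "x \<in> carrier L" "x \<noteq> \<bottom>" "u \<in> carrier L" "v \<in> carrier L" "u \<noteq> \<bottom>" "v \<noteq> \<bottom>"
        "x \<sqsubset> u" "x \<sqsubset> v" "\<not> u \<sqsubset> v" "\<not> v \<sqsubset> u"
        using that by (auto simp: covers_def)
      then show ?thesis
        using upper_sets_chains_exceptD[OF cc, of x u v] by (auto simp: lless_iff)
    qed
    then show "undirected_tree (cover_graph ?N)"
      using conn N.acyclic_cover_graph unfolding undirected_tree_def by blast
  qed
qed

section \<open>The zero-divisor graph\<close>

text \<open>For the arcs this is the meet form of the chain condition, as comparable nonzero
  elements have a nonzero meet. For the vertices, join-reducibility of \<open>\<top>\<close> makes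
  every element other than \<open>\<bottom>\<close> and \<open>\<top>\<close> a zero
  divisor.\<close>

lemma zero_divisor_graph_iff_chain_condition:
  assumes "join_reducible L \<top>"
  shows "zero_divisor_graph L = incomparability_graph (subposet L (carrier L - {\<bottom>, \<top>})) \<longleftrightarrow>
    chain_condition"
proof
  assume eq: "zero_divisor_graph L = incomparability_graph (subposet L (carrier L - {\<bottom>, \<top>}))"
  show chain_condition
  proof (rule ccontr)
    assume "\<not> chain_condition"
    then obtain y z where yz: "y \<in> carrier L" "z \<in> carrier L" "\<not> y \<sqsubseteq> z" "\<not> z \<sqsubseteq> y" "y \<sqinter> z \<noteq> \<bottom>"
      by (rule not_chain_conditionE)
    then have "y \<notin> {\<bottom>, \<top>}" "z \<notin> {\<bottom>, \<top>}" using bottom_le top_ge by auto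
    with yz have "(y, z) \<in> parcs (incomparability_graph (subposet L (carrier L - {\<bottom>, \<top>})))"
      by (simp add: incomparability_graph_def)
    with yz(5) show False by (simp flip: eq add: zero_divisor_graph_def)
  qed
next
  assume cc: chain_condition
  obtain y z where yz: "y \<in> carrier L" "z \<in> carrier L" "y \<noteq> \<top>" "z \<noteq> \<top>" "y \<squnion> z = \<top>"
      "\<not> y \<sqsubseteq> z" "\<not> z \<sqsubseteq> y"
    using assms by (rule top_join_reducibleE)
  have meet_iff: "a \<sqinter> b = \<bottom> \<longleftrightarrow> \<not> a \<sqsubseteq> b \<and> \<not> b \<sqsubseteq> a"
    if "a \<in> carrier L" "b \<in> carrier L" "a \<noteq> \<bottom>" "b \<noteq> \<bottom>" for a b
    using that chain_conditionD[OF cc, of a b] meet_absorb_left[of a b] meet_absorb_left[of b a]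
    by (auto simp: meet_comm)
  have nonbot: "y \<noteq> \<bottom>" "z \<noteq> \<bottom>" using yz bottom_le by auto
  have verts: "zero_divisors L = carrier L - {\<bottom>, \<top>}"
  proof (intro equalityI subsetI)
    fix x assume "x \<in> zero_divisors L"
    then show "x \<in> carrier L - {\<bottom>, \<top>}"
      using meet_iff[of "\<top>"] top_ge top_closed by (auto simp: zero_divisors_def)
  next
    fix x assume x: "x \<in> carrier L - {\<bottom>, \<top>}"
    \<comment> \<open>Otherwise \<open>x\<close> lies below both \<open>y\<close> and
      \<open>z\<close>, or between them, and they are comparable; or it lies above both, and so
      equals their join \<open>\<top>\<close>.\<close>
    have "\<not> (x \<sqsubseteq> y \<or> y \<sqsubseteq> x) \<or> \<not> (x \<sqsubseteq> z \<or> z \<sqsubseteq> x)"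
    proof (rule ccontr)
      assume "\<not> ?thesis"
      then consider "x \<sqsubseteq> y" "x \<sqsubseteq> z" | "y \<sqsubseteq> x" "x \<sqsubseteq> z" | "z \<sqsubseteq> x" "x \<sqsubseteq> y" | "y \<sqsubseteq> x" "z \<sqsubseteq> x"
        by blast
      then show False
      proof cases
        case 1
        then show ?thesis using upper_sets_chains_exceptD[OF cc, of x y z] x yz by auto
      next
        case 2
        then show ?thesis using le_trans[of y x z] x yz by auto
      next
        case 3
        then show ?thesis using le_trans[of z x y] x yz by auto
      next
        case 4
        then have "\<top> \<sqsubseteq> x" using join_le[of y x z] x yz by auto
        then show ?thesis using x top_ge top_closed le_antisym by blast
      qed
    qed
    then show "x \<in> zero_divisors L"
      using x yz nonbot meet_iff[of x y] meet_iff[of x z] by (auto simp: zero_divisors_def)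
  qed
  show "zero_divisor_graph L = incomparability_graph (subposet L (carrier L - {\<bottom>, \<top>}))"
    unfolding zero_divisor_graph_def incomparability_graph_def verts
    using meet_iff by auto
qed

end

theorem theorem2p13:
  fixes L :: "'a gorder"
  assumes "finite_lattice L"
    and "join_reducible L \<top>\<^bsub>L\<^esub>"
  shows "(lower_dismantlable L \<longleftrightarrow>
            (\<forall>x\<in>carrier L - {\<bottom>\<^bsub>L\<^esub>}. meet_irreducible L x))
       \<and> ((\<forall>x\<in>carrier L - {\<bottom>\<^bsub>L\<^esub>}. meet_irreducible L x) \<longleftrightarrow>
            undirected_tree (cover_graph (subposet L (carrier L - {\<bottom>\<^bsub>L\<^esub>}))))
       \<and> (undirected_tree (cover_graph (subposet L (carrier L - {\<bottom>\<^bsub>L\<^esub>}))) \<longleftrightarrow>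
            zero_divisor_graph L =
              incomparability_graph (subposet L (carrier L - {\<bottom>\<^bsub>L\<^esub>, \<top>\<^bsub>L\<^esub>})))"
proof -
  interpret lattice L
    using assms(1) by (simp add: finite_lattice_def)
  interpret nonempty_finite_lattice L
    using assms(1) by unfold_locales (auto simp: finite_lattice_def)
  \<comment> \<open>If the bounds coincided, this element would be below \<open>\<bottom>\<close>
    and so equal to \<open>\<top>\<close>.\<close>
  obtain y where "y \<in> carrier L" "y \<noteq> \<top>\<^bsub>L\<^esub>"
    using assms(2) by (rule top_join_reducibleE)
  then have "\<bottom>\<^bsub>L\<^esub> \<noteq> \<top>\<^bsub>L\<^esub>"
    using bottom_unique top_ge by metis
  then show ?thesis
    using lower_dismantlable_iff_chain_condition[OF assms(2)] meet_irreducible_iff_chain_condition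
      cover_graph_tree_iff_chain_condition zero_divisor_graph_iff_chain_condition[OF assms(2)]
    by blast
qed

end
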